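(* Let $\Delta\ge 2$ and $t\ge 2\Delta+1$ be integers, let $G$ be a graph of maximum degree $\Delta$, and let $\mathcal{U}$ be a partition of $V(G)$ into blocks each of size at least $t$. Then every independent transversal of $(G,\mathcal{U})$ is reconfigurable to every other independent transversal of $(G,\mathcal{U})$; that is, the reconfigurability graph of $(G,\mathcal{U})$ is connected.
   Context: Graphs are finite and simple. Let $G$ be a graph and $\mathcal{U}$ a partition of $V(G)$ (its members are called blocks). An independent transversal of $\mathcal{G}=(G,\mathcal{U})$ is an independent set $S$ of $G$ with $|S\cap U|=1$ for all $U\in\mathcal{U}$; $\operatorname{IT}(\mathcal{G})$ denotes the set of independent transversals of $\mathcal{G}$. The reconfigurability graph of $\mathcal{G}$ has vertex set $\operatorname{IT}(\mathcal{G})$, with $S$ and $T$ adjacent if and only if $S\cup T$ is an independent set of $G$ of size $|\mathcal{U}|+1$ (i.e. $S$ and $T$ agree on all but one block, and on that block their respective vertices are distinct and not adjacent in $G$). $S$ is reconfigurable to $T$ if they lie in the same connected component of the reconfigurability graph. *)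

theory Defs
  imports "Graph_Theory.Graph_Theory" "HOL-Library.Disjoint_Sets"
begin

text \<open>
  Finite simple graphs are the finite, loop-free, symmetric pair digraphs \<open>pair_graph\<close>.  An
  undirected edge is represented by its two arcs, so the degree of a vertex is its out-degree.
\<close>

definition max_degree :: "'a pair_pre_digraph \<Rightarrow> nat" where
  "max_degree G = Max (insert 0 ((\<lambda>v. out_degree (with_proj G) v) ` pverts G))"

definition independent :: "'a pair_pre_digraph \<Rightarrow> 'a set \<Rightarrow> bool" where
  "independent G S \<longleftrightarrow> S \<subseteq> pverts G \<and> (\<forall>u\<in>S. \<forall>v\<in>S. (u, v) \<notin> parcs G)"

definition IT :: "'a pair_pre_digraph \<Rightarrow> 'a set set \<Rightarrow> 'a set set" where
  "IT G \<U> = {S. independent G S \<and> (\<forall>U\<in>\<U>. card (S \<inter> U) = 1)}"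

definition reconf_graph :: "'a pair_pre_digraph \<Rightarrow> 'a set set \<Rightarrow> 'a set pair_pre_digraph" where
  "reconf_graph G \<U> =
    \<lparr>pverts = IT G \<U>,
     parcs = {(S, T). S \<in> IT G \<U> \<and> T \<in> IT G \<U> \<and>
       independent G (S \<union> T) \<and> card (S \<union> T) = card \<U> + 1}\<rparr>"

text \<open>
  The reconfigurability graph is symmetric, so its strongly connected components are its
  connected components; \<open>sccs_verts\<close> is the set of their vertex sets.
\<close>

definition reconfigurable :: "'a pair_pre_digraph \<Rightarrow> 'a set set \<Rightarrow> 'a set \<Rightarrow> 'a set \<Rightarrow> bool" where
  "reconfigurable G \<U> S T \<longleftrightarrow>
    (\<exists>C \<in> pre_digraph.sccs_verts (with_proj (reconf_graph G \<U>)). S \<in> C \<and> T \<in> C)"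

lemma card_IT:
  assumes G: "pair_graph G" and P: "partition_on (pverts G) \<U>" and S: "S \<in> IT G \<U>"
  shows "card S = card \<U>"
proof -
  have fin: "finite (pverts G)" using G pair_fin_digraph.pair_finite_verts
    by (auto simp: pair_graph_def pair_digraph_def)
  have SV: "S \<subseteq> pverts G" using S by (simp add: IT_def independent_def)
  have "S = (\<Union>U\<in>\<U>. S \<inter> U)" using SV P by (auto simp: partition_on_def)
  moreover have "card (\<Union>U\<in>\<U>. S \<inter> U) = (\<Sum>U\<in>\<U>. card (S \<inter> U))"
  proof (rule card_UN_disjoint)
    show "finite \<U>" using fin P by (simp add: finite_elements)
    show "\<forall>U\<in>\<U>. finite (S \<inter> U)" using fin SV finite_subset by blast
    show "\<forall>U\<in>\<U>. \<forall>W\<in>\<U>. U \<noteq> W \<longrightarrow> S \<inter> U \<inter> (S \<inter> W) = {}"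
      using P by (auto simp: partition_on_def disjoint_def)
  qed
  moreover have "(\<Sum>U\<in>\<U>. card (S \<inter> U)) = card \<U>" using S by (simp add: IT_def)
  ultimately show ?thesis by simp
qed

lemma pair_graph_reconf_graph:
  assumes G: "pair_graph G" and P: "partition_on (pverts G) \<U>"
  shows "pair_graph (reconf_graph G \<U>)"
proof -
  have fin: "finite (pverts G)" using G pair_fin_digraph.pair_finite_verts
    by (auto simp: pair_graph_def pair_digraph_def)
  have finIT: "finite (IT G \<U>)"
    by (rule finite_subset[of _ "Pow (pverts G)"]) (auto simp: IT_def independent_def fin)
  have finA: "finite (parcs (reconf_graph G \<U>))"
    by (rule finite_subset[of _ "IT G \<U> \<times> IT G \<U>"]) (auto simp: reconf_graph_def finIT)
  have "sym (parcs (reconf_graph G \<U>))"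
    by (auto simp: sym_def reconf_graph_def Un_commute)
  then have symm: "symmetric (with_proj (reconf_graph G \<U>))"
    by (simp add: symmetric_def arcs_ends_def arc_to_ends_def)
  show ?thesis
    by unfold_locales
      (use finIT finA symm card_IT[OF G P] in \<open>auto simp: reconf_graph_def\<close>)
qed

lemma reconfigurable_iff_reachable:
  assumes G: "pair_graph G" and P: "partition_on (pverts G) \<U>"
  shows "reconfigurable G \<U> S T \<longleftrightarrow> reachable (with_proj (reconf_graph G \<U>)) S T"
proof -
  interpret R: pair_graph "reconf_graph G \<U>" by (rule pair_graph_reconf_graph[OF G P])
  show ?thesis
    unfolding reconfigurable_def R.in_sccs_verts_conv_reachable
    using R.symmetric_reachable' R.scc_of_in_sccs_verts R.in_scc_of_self
    by (smt (verit) R.reachable_in_verts R.scc_of_def mem_Collect_eq R.in_sccs_verts_conv_reachable)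
qed

text \<open>
  The library's \<open>connected\<close> additionally asks for a nonempty vertex set.
\<close>

lemma connected_reconf_graph_iff:
  assumes G: "pair_graph G" and P: "partition_on (pverts G) \<U>" and "IT G \<U> \<noteq> {}"
  shows "connected (with_proj (reconf_graph G \<U>)) \<longleftrightarrow>
    (\<forall>S \<in> IT G \<U>. \<forall>T \<in> IT G \<U>. reconfigurable G \<U> S T)"
proof -
  interpret R: pair_graph "reconf_graph G \<U>" by (rule pair_graph_reconf_graph[OF G P])
  have "connected (with_proj (reconf_graph G \<U>)) \<longleftrightarrow> strongly_connected (with_proj (reconf_graph G \<U>))"
  proof
    assume "connected (with_proj (reconf_graph G \<U>))"
    then show "strongly_connected (with_proj (reconf_graph G \<U>))"
      using R.symmetric_connected_imp_strongly_connected R.sym_arcs by blast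
  next
    assume sc: "strongly_connected (with_proj (reconf_graph G \<U>))"
    have "arcs_ends (with_proj (mk_symmetric (with_proj (reconf_graph G \<U>)))) =
      arcs_ends (with_proj (reconf_graph G \<U>))"
      using R.sym_arcs unfolding symmetric_def sym_def arcs_ends_def arc_to_ends_def
      by (auto simp: mk_symmetric_def arcs_ends_def arc_to_ends_def)
    then show "connected (with_proj (reconf_graph G \<U>))"
      using sc by (simp add: connected_def strongly_connected_def reachable_def mk_symmetric_def)
  qed
  then show ?thesis
    using assms(3)
    by (auto simp: strongly_connected_def reconfigurable_iff_reachable[OF G P])
      (auto simp: reconf_graph_def)
qed

end

theory Submission
  imports Defs
begin

text \<open>
  Move both transversals \<open>S\<close> and \<open>T\<close> so that they agree on more and more blocks. If \<open>D\<close> is the set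
  of blocks on which they differ, the at most \<open>2 |D|\<close> vertices of \<open>S \<union> T\<close> in \<open>D\<close> cannot dominate
  \<open>\<Union>D\<close>, so some \<open>w\<close> in \<open>\<Union>D\<close> is adjacent to vertices of \<open>S \<inter> T\<close> only. As in Haxell's theorem, these
  neighbours are removed one at a time by simultaneous moves of \<open>S\<close> and \<open>T\<close> in common blocks: adding
  \<open>w\<close>, its neighbours \<open>Y\<close> and their blocks preserves the bound ``at most two vertices per block'',
  because \<open>1 + |Y| \<le> 2 |Y|\<close>. Once \<open>w\<close> is free, both transversals move to \<open>w\<close>.
\<close>

text \<open>
  \<open>W\<close> plays the role of \<open>S \<union> T\<close>: one swap moves both transversals to \<open>w\<close> in a block outside the
  frozen set \<open>K\<close>, where they agree; the vertices of \<open>A\<close> must not acquire neighbours in \<open>W\<close>.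
\<close>

definition swap ::
  "('a \<times> 'a) set \<Rightarrow> 'a set set \<Rightarrow> 'a set set \<Rightarrow> 'a set \<Rightarrow> 'a set \<Rightarrow> 'a set \<Rightarrow> bool" where
  "swap E \<U> K A W W' \<longleftrightarrow>
    (\<exists>U \<in> \<U> - K. \<exists>w \<in> U. (\<forall>z \<in> W \<union> A. (w, z) \<notin> E) \<and> W' = insert w (W - U))"

section \<open>Invariants of swap sequences\<close>

lemma swap_mono:
  assumes "swap E \<U> K' A' W W'" "K \<subseteq> K'" "A \<subseteq> A'"
  shows "swap E \<U> K A W W'"
  using assms unfolding swap_def by blast

text \<open>Enlarging \<open>K\<close> and \<open>A\<close> only adds restrictions. This brings
  swaps found in a recursive call, with more frozen blocks, back to the original setting.\<close>

lemma swaps_mono: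
  assumes "(swap E \<U> K' A')\<^sup>*\<^sup>* W W'" "K \<subseteq> K'" "A \<subseteq> A'"
  shows "(swap E \<U> K A)\<^sup>*\<^sup>* W W'"
  using assms(1) by (rule rtranclp_mono[THEN predicate2D, rotated]) (use swap_mono assms in blast)

lemma swaps_fixed:
  assumes "(swap E \<U> K A)\<^sup>*\<^sup>* W W'" "disjoint \<U>" "U \<in> \<U>" "U \<in> K"
  shows "W' \<inter> U = W \<inter> U"
  using assms(1)
proof induction
  case (step W' W'')
  then obtain X w where X: "X \<in> \<U> - K" "w \<in> X" "W'' = insert w (W' - X)"
    unfolding swap_def by blast
  then have "X \<inter> U = {}" using assms(2-4) disjointD by (metis DiffD1 DiffD2)
  then show ?case using X step.IH by blast
qed simp

lemma swaps_singleton: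
  assumes "(swap E \<U> K A)\<^sup>*\<^sup>* W W'" "disjoint \<U>" "\<forall>U \<in> \<U> - K. \<exists>y. W \<inter> U = {y}"
  shows "\<forall>U \<in> \<U> - K. \<exists>y. W' \<inter> U = {y}"
  using assms(1)
proof induction
  case (step W' W'')
  then obtain U w where U: "U \<in> \<U> - K" "w \<in> U" "W'' = insert w (W' - U)"
    unfolding swap_def by blast
  show ?case
  proof
    fix X assume X: "X \<in> \<U> - K"
    show "\<exists>y. W'' \<inter> X = {y}"
    proof (cases "X = U")
      case True
      then have "W'' \<inter> X = {w}" using U by blast
      then show ?thesis by blast
    next
      case False
      then have "W'' \<inter> X = W' \<inter> X" using U X assms(2) by (auto simp: disjoint_def)
      then show ?thesis using step.IH X by auto
    qed
  qed
qed (use assms in simp)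

lemma swaps_subset:
  assumes "(swap E \<U> K A)\<^sup>*\<^sup>* W W'" "W \<subseteq> \<Union>\<U>"
  shows "W' \<subseteq> \<Union>\<U>"
  using assms(1)
proof induction
  case (step W' W'')
  then show ?case unfolding swap_def by blast
qed (rule assms)

text \<open>Each vertex brought in is nonadjacent to all of \<open>A\<close>, so the neighbours of a
  protected \<open>w\<close> can only be lost along the way.\<close>

lemma swaps_nbhd:
  assumes "(swap E \<U> K A)\<^sup>*\<^sup>* W W'" "sym E" "w \<in> A"
  shows "E `` {w} \<inter> W' \<subseteq> E `` {w} \<inter> W"
  using assms(1)
proof induction
  case (step W' W'')
  then obtain U x where "(x, w) \<notin> E" "W'' = insert x (W' - U)"
    unfolding swap_def using assms(3) by blast
  then show ?case using step.IH assms(2) by (auto dest: symD)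
qed simp

text \<open>Counting: \<open>A\<close> dominates at most \<open>2 * card K * \<Delta>\<close>
  vertices, while the disjoint blocks of \<open>K\<close> hold at least
  \<open>card K * (2 * \<Delta> + 1)\<close>.\<close>

lemma not_dominated:
  assumes fin: "finite (\<Union>\<U>)" "disjoint \<U>" and size: "\<forall>U\<in>\<U>. 2 * \<Delta> + 1 \<le> card U"
    and deg: "\<forall>v. card (E `` {v}) \<le> \<Delta>" and fE: "finite E"
    and K: "K \<subseteq> \<U>" "K \<noteq> {}" and A: "finite A" "card A \<le> 2 * card K"
  shows "\<exists>w \<in> \<Union>K. \<forall>z\<in>A. (z, w) \<notin> E"
proof (rule ccontr)
  assume "\<not> ?thesis"
  then have sub: "\<Union>K \<subseteq> (\<Union>a\<in>A. E `` {a})" by blast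
  have finK: "finite K" using fin(1) K(1) finite_UnionD finite_subset by metis
  have "card (\<Union>a\<in>A. E `` {a}) \<le> (\<Sum>a\<in>A. card (E `` {a}))" by (rule card_UN_le[OF A(1)])
  also have "\<dots> \<le> card A * \<Delta>" using sum_bounded_above[of A "\<lambda>a. card (E `` {a})" \<Delta>] deg by simp
  also have "\<dots> \<le> 2 * card K * \<Delta>" using A(2) by (rule mult_right_mono) simp
  finally have upper: "card (\<Union>a\<in>A. E `` {a}) \<le> 2 * card K * \<Delta>" .
  have "card (\<Union>K) = sum card K"
  proof (rule card_Union_disjoint)
    show "pairwise disjnt K" using fin(2) K(1) by (auto simp: pairwise_def disjnt_def disjoint_def)
    show "finite U" if "U \<in> K" for U using that K(1) fin(1) by (meson Union_upper finite_subset subsetD)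
  qed
  moreover have "card K * (2 * \<Delta> + 1) \<le> sum card K"
    using sum_bounded_below[of K "2 * \<Delta> + 1" card] size K(1) by auto
  moreover have "card (\<Union>K) \<le> card (\<Union>a\<in>A. E `` {a})"
    using sub A(1) fE by (intro card_mono) (auto intro: finite_Image)
  \<comment> \<open>The two bounds differ by \<open>card K\<close>, so nonemptiness of
    \<open>K\<close> makes the inequality strict.\<close>
  moreover have "card K > 0" using finK K(2) by (simp add: card_gt_0_iff)
  ultimately show False using upper by (simp add: algebra_simps)
qed

text \<open>Induction on the number of unfrozen blocks. For an undominated \<open>w\<close>, swaps
  bring its neighbours in \<open>W\<close> to a minimum. If some remain, freezing their blocks and
  recursing yields either the desired vertex or one more swap that beats the minimum.\<close>

lemma swaps_free_vertex:
  assumes fin: "finite (\<Union>\<U>)" "disjoint \<U>" and size: "\<forall>U\<in>\<U>. 2 * \<Delta> + 1 \<le> card U"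
    and deg: "\<forall>v. card (E `` {v}) \<le> \<Delta>" and E: "finite E" "sym E"
    and "K \<subseteq> \<U>" "K \<noteq> {}" "finite A" "card A \<le> 2 * card K"
    and "W \<subseteq> \<Union>\<U>" "W \<inter> \<Union>K \<subseteq> A" "\<forall>U \<in> \<U> - K. \<exists>y. W \<inter> U = {y}"
  shows "\<exists>W' w. (swap E \<U> K A)\<^sup>*\<^sup>* W W' \<and> w \<in> \<Union>K \<and> (\<forall>z \<in> W' \<union> A. (w, z) \<notin> E)"
  using assms(7-)
proof (induction "card (\<U> - K)" arbitrary: K A W rule: less_induct)
  case less
  have finU: "finite \<U>" using fin(1) finite_UnionD by blast
  obtain w where w: "w \<in> \<Union>K" "\<forall>z\<in>A. (z, w) \<notin> E"
    using not_dominated[OF fin size deg E(1) less.prems(1-4)] by blast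
  have wA: "(w, z) \<notin> E" if "z \<in> A" for z using w(2) that E(2) by (auto dest: symD)
  \<comment> \<open>\<open>P\<close> holds for \<open>W\<close> itself, so the minimum is attained;
    every configuration built below is compared with \<open>W1\<close>.\<close>
  define P where "P = (\<lambda>W'. (swap E \<U> K A)\<^sup>*\<^sup>* W W')"
  define W1 where "W1 = arg_min (\<lambda>W'. card (E `` {w} \<inter> W')) P"
  have P1: "P W1" and min: "\<And>W'. P W' \<Longrightarrow> card (E `` {w} \<inter> W1) \<le> card (E `` {w} \<inter> W')"
    unfolding W1_def using arg_min_nat_lemma[of P W "\<lambda>W'. card (E `` {w} \<inter> W')"]
    by (auto simp: P_def)
  note W1 = P1[unfolded P_def]
  have sub1: "W1 \<subseteq> \<Union>\<U>" using swaps_subset[OF W1 less.prems(5)] .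
  have fix1: "W1 \<inter> \<Union>K \<subseteq> A" using swaps_fixed[OF W1 fin(2)] less.prems(1,6) by blast
  have sing1: "\<forall>U \<in> \<U> - K. \<exists>y. W1 \<inter> U = {y}" using swaps_singleton[OF W1 fin(2) less.prems(7)] .
  define Y where "Y = E `` {w} \<inter> W1"
  have finY: "finite Y" unfolding Y_def using E(1) by (auto intro: finite_Image)
  show ?case
  proof (cases "Y = {}")
    case True
    then have "\<forall>z \<in> W1 \<union> A. (w, z) \<notin> E" using wA by (auto simp: Y_def)
    then show ?thesis using W1 w(1) by blast
  next
    case False
    define B where "B = {U \<in> \<U>. U \<inter> Y \<noteq> {}}"
    have YA: "Y \<inter> A = {}" using wA by (auto simp: Y_def)
    \<comment> \<open>Inside \<open>K\<close> the set \<open>W1\<close> lies in \<open>A\<close>,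
      which misses the neighbours of \<open>w\<close>. So each block of \<open>B\<close> is unfrozen
      and its only vertex of \<open>W1\<close> is in \<open>Y\<close>.\<close>
    have BK: "B \<inter> K = {}" using fix1 YA by (auto simp: B_def Y_def)
    have BY: "\<exists>y. y \<in> Y \<and> W1 \<inter> U = {y}" if "U \<in> B" for U
    proof -
      have "U \<in> \<U> - K" using that BK by (auto simp: B_def)
      then obtain y where y: "W1 \<inter> U = {y}" using sing1 by blast
      then have "y \<in> Y" using that by (auto simp: B_def Y_def)
      with y show ?thesis by blast
    qed
    have "card B = card Y"
    proof (rule bij_betw_same_card)
      have "inj_on (\<lambda>U. the_elem (W1 \<inter> U)) B"
      proof (rule inj_onI)
        fix U X assume UX: "U \<in> B" "X \<in> B" "the_elem (W1 \<inter> U) = the_elem (W1 \<inter> X)"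
        obtain u x where "W1 \<inter> U = {u}" "W1 \<inter> X = {x}" using BY UX by metis
        with UX(3) have "u = x" by simp
        then have "U \<inter> X \<noteq> {}" using \<open>W1 \<inter> U = {u}\<close> \<open>W1 \<inter> X = {x}\<close> by blast
        then show "U = X" using UX fin(2) by (auto simp: B_def disjoint_def)
      qed
      moreover have "(\<lambda>U. the_elem (W1 \<inter> U)) ` B = Y"
      proof
        show "(\<lambda>U. the_elem (W1 \<inter> U)) ` B \<subseteq> Y" using BY by fastforce
        show "Y \<subseteq> (\<lambda>U. the_elem (W1 \<inter> U)) ` B"
        proof
          fix y assume y: "y \<in> Y"
          then obtain U where U: "U \<in> \<U>" "y \<in> U" using sub1 by (auto simp: Y_def)
          then have UB: "U \<in> B" using y by (auto simp: B_def)
          have "y \<in> W1 \<inter> U" using y U by (simp add: Y_def)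
          then have "the_elem (W1 \<inter> U) = y" using BY[OF UB] by (metis singletonD the_elem_eq)
          then show "y \<in> (\<lambda>U. the_elem (W1 \<inter> U)) ` B" using UB by (metis imageI)
        qed
      qed
      ultimately show "bij_betw (\<lambda>U. the_elem (W1 \<inter> U)) B Y" by (simp add: bij_betw_def)
    qed
    moreover have finBK: "finite B" "finite K"
      using finU less.prems(1) finite_subset by (auto simp: B_def)
    ultimately have cK: "card (K \<union> B) = card K + card Y" using BK by (simp add: card_Un_disjoint Int_commute)
    have cY: "card Y \<ge> 1" using False finY by (simp add: Suc_leI card_gt_0_iff)
    \<comment> \<open>\<open>Y\<close> is what \<open>W1\<close> occupies in the newly frozen
      blocks; \<open>w\<close> is protected so that the recursion gives it no new
      neighbours.\<close>
    let ?K = "K \<union> B" and ?A = "insert w (A \<union> Y)"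
    have "B \<noteq> {}" using cY cK by auto
    then have "\<U> - ?K \<subset> \<U> - K" using BK by (auto simp: B_def)
    then have lt: "card (\<U> - ?K) < card (\<U> - K)" using finU by (simp add: psubset_card_mono)
    have "card ?A \<le> 1 + (card A + card Y)"
      using card_insert_le_m1 card_Un_le[of A Y] finY less.prems(3)
      by (simp add: card_insert_if)
    \<comment> \<open>\<open>A\<close> grows by at most \<open>1 + card Y\<close>, the bound by
      \<open>2 * card Y\<close>; this is enough because \<open>card Y \<ge> 1\<close>.\<close>
    then have cA: "card ?A \<le> 2 * card ?K" using cK cY less.prems(4) by linarith
    have "W1 \<inter> U \<subseteq> Y" if "U \<in> B" for U
      using BY[OF that] by (metis empty_subsetI insert_subset)
    then have "W1 \<inter> \<Union>?K \<subseteq> ?A" using fix1 by auto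
    moreover have "?K \<subseteq> \<U>" "?K \<noteq> {}" using less.prems(1,2) by (auto simp: B_def)
    moreover have "finite ?A" using less.prems(3) finY by simp
    moreover have "\<forall>U \<in> \<U> - ?K. \<exists>y. W1 \<inter> U = {y}" using sing1 by simp
    ultimately obtain W2 w' where W2: "(swap E \<U> ?K ?A)\<^sup>*\<^sup>* W1 W2" and w': "w' \<in> \<Union>?K"
      "\<forall>z \<in> W2 \<union> ?A. (w', z) \<notin> E"
      using less.hyps[OF lt _ _ _ cA sub1] by meson
    have "(swap E \<U> K A)\<^sup>*\<^sup>* W1 W2" by (rule swaps_mono[OF W2]) auto
    then have P2: "P W2" using W1 unfolding P_def by simp
    show ?thesis
    proof (cases "w' \<in> \<Union>K")
      case True
      then show ?thesis using P2 w'(2) unfolding P_def by blast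
    next
      case False
      then obtain U where U: "U \<in> B" "w' \<in> U" using w'(1) by blast
      then have "U \<in> \<U> - K" using BK by (auto simp: B_def)
      then have "swap E \<U> K A W2 (insert w' (W2 - U))" using U w'(2) unfolding swap_def by blast
      then have P3: "P (insert w' (W2 - U))" using P2 unfolding P_def by simp
      \<comment> \<open>Moving to \<open>w'\<close> in \<open>U\<close> discards the neighbour
        \<open>y\<close> of \<open>w\<close>. Neither the recursive swaps nor \<open>w'\<close>,
        nonadjacent to \<open>w\<close>, adds a neighbour, contradicting minimality.\<close>
      obtain y where y: "y \<in> Y" "W1 \<inter> U = {y}" using BY[OF U(1)] by blast
      have "(w, w') \<notin> E" using w'(2) E(2) by (auto dest: symD)
      then have "E `` {w} \<inter> insert w' (W2 - U) \<subseteq> Y - {y}"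
        using swaps_nbhd[OF W2 E(2)] y by (auto simp: Y_def)
      then have "card (E `` {w} \<inter> insert w' (W2 - U)) < card Y"
        using y(1) finY by (metis card_Diff1_less card_mono finite_Diff le_less_trans)
      then show ?thesis using min[OF P3] by (simp add: Y_def)
    qed
  qed
qed

section \<open>From swaps to moves of independent transversals\<close>

lemma IT_Int_block:
  assumes "S \<in> IT G \<U>" "U \<in> \<U>"
  shows "\<exists>y. S \<inter> U = {y}"
  using assms by (auto simp: IT_def card_1_singleton_iff)

lemma pverts_reconf_graph [simp]: "pverts (reconf_graph G \<U>) = IT G \<U>"
  by (simp add: reconf_graph_def)

text \<open>Since \<open>w\<close> is nonadjacent to all of \<open>S\<close>, including the vertex
  it replaces, \<open>insert w S\<close> is independent, as an edge of the reconfigurability graph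
  demands.\<close>

lemma IT_exchange:
  assumes G: "pair_graph G" and P: "partition_on (pverts G) \<U>"
    and S: "S \<in> IT G \<U>" and U: "U \<in> \<U>" "w \<in> U" and free: "\<forall>z\<in>S. (w, z) \<notin> parcs G"
  shows "insert w (S - U) \<in> IT G \<U>" (is "?S \<in> _")
    and "reachable (with_proj (reconf_graph G \<U>)) S (insert w (S - U))"
proof -
  interpret G: pair_graph G by (rule G)
  interpret R: pair_graph "reconf_graph G \<U>" by (rule pair_graph_reconf_graph[OF G P])
  have sym: "(u, v) \<in> parcs G \<Longrightarrow> (v, u) \<in> parcs G" for u v
    using G.sym_arcs by (auto simp: symmetric_def sym_def)
  have loop: "(w, w) \<notin> parcs G" using G.no_loops by fastforce
  have wV: "w \<in> pverts G" using U P by (auto simp: partition_on_def)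
  have ind: "independent G (insert w S)"
    using S free sym loop wV unfolding IT_def independent_def by blast
  then have ind': "independent G ?S" unfolding independent_def by blast
  moreover have "card (?S \<inter> X) = 1" if X: "X \<in> \<U>" for X
  proof (cases "X = U")
    case True
    then have "?S \<inter> X = {w}" using U by blast
    then show ?thesis by simp
  next
    case False
    then have "?S \<inter> X = S \<inter> X" using X U P by (auto simp: partition_on_def disjoint_def)
    then show ?thesis using S X by (simp add: IT_def)
  qed
  ultimately show IT: "?S \<in> IT G \<U>" by (simp add: IT_def)
  show "reachable (with_proj (reconf_graph G \<U>)) S ?S"
  \<comment> \<open>A swap may reinsert the vertex already present; the transversal then stays
    put.\<close>
  proof (cases "w \<in> S")
    case True
    then have "S \<inter> U = {w}" using IT_Int_block[OF S U(1)] U(2) by (metis IntI singletonD)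
    then have "?S = S" by blast
    then show ?thesis using S by simp
  next
    case False
    have "finite S" using S G.pair_finite_verts by (auto simp: IT_def independent_def intro: finite_subset)
    moreover have "S \<union> ?S = insert w S" by blast
    ultimately have "card (S \<union> ?S) = card \<U> + 1" "independent G (S \<union> ?S)"
      using False card_IT[OF G P S] ind by simp_all
    then have "(S, ?S) \<in> parcs (reconf_graph G \<U>)" using S IT by (simp add: reconf_graph_def)
    then show ?thesis by (intro R.reachable_adjI) (simp add: arcs_ends_def arc_to_ends_def)
  qed
qed

text \<open>The vertex of each swap is nonadjacent to the whole union, so both transversals can make
  the same move, which preserves their agreement outside \<open>K\<close>.\<close>

lemma swaps_lift:
  assumes G: "pair_graph G" and P: "partition_on (pverts G) \<U>"
    and ST: "S \<in> IT G \<U>" "T \<in> IT G \<U>" and agree: "\<forall>U \<in> \<U> - K. S \<inter> U = T \<inter> U"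
    and sw: "(swap (parcs G) \<U> K A)\<^sup>*\<^sup>* (S \<union> T) W"
  shows "\<exists>S' T'. S' \<in> IT G \<U> \<and> T' \<in> IT G \<U> \<and> W = S' \<union> T' \<and> (\<forall>U \<in> \<U> - K. S' \<inter> U = T' \<inter> U) \<and>
    reachable (with_proj (reconf_graph G \<U>)) S S' \<and> reachable (with_proj (reconf_graph G \<U>)) T T'"
proof -
  interpret R: pair_graph "reconf_graph G \<U>" by (rule pair_graph_reconf_graph[OF G P])
  show ?thesis
    using sw
  proof induction
    case base
    have "reachable (with_proj (reconf_graph G \<U>)) X X" if "X \<in> IT G \<U>" for X
      using that by simp
    from this[OF ST(1)] this[OF ST(2)] show ?case using ST agree by (intro exI[of _ S] exI[of _ T]) simp
  next
    case (step W W')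
    obtain S' T' where IH: "S' \<in> IT G \<U>" "T' \<in> IT G \<U>" "W = S' \<union> T'"
      "\<forall>U \<in> \<U> - K. S' \<inter> U = T' \<inter> U"
      "reachable (with_proj (reconf_graph G \<U>)) S S'" "reachable (with_proj (reconf_graph G \<U>)) T T'"
      using step.IH by blast
    obtain U w where U: "U \<in> \<U> - K" "w \<in> U" "\<forall>z \<in> W. (w, z) \<notin> parcs G" "W' = insert w (W - U)"
      using step.hyps(2) unfolding swap_def by blast
    have "W' = insert w (S' - U) \<union> insert w (T' - U)" using U IH by blast
    moreover have "\<forall>X \<in> \<U> - K. insert w (S' - U) \<inter> X = insert w (T' - U) \<inter> X" using IH(4) by blast
    moreover have "insert w (X - U) \<in> IT G \<U>"
      "reachable (with_proj (reconf_graph G \<U>)) X (insert w (X - U))" if "X \<in> {S', T'}" for X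
      using IT_exchange[OF G P _ _ U(2), of X] that U(1,3) IH(1-3) by auto
    ultimately show ?case
      using IH(5,6)[THEN R.reachable_trans]
      by (intro exI[of _ "insert w (S' - U)"] exI[of _ "insert w (T' - U)"]) simp
  qed
qed

section \<open>Induction on the number of blocks of disagreement\<close>

theorem mainTheorem2:
  fixes G :: "'a pair_pre_digraph" and \<U> :: "'a set set" and \<Delta> t :: nat
  assumes "\<Delta> \<ge> 2" and "t \<ge> 2 * \<Delta> + 1"
    and "pair_graph G" and "max_degree G = \<Delta>"
    and "partition_on (pverts G) \<U>" and "\<forall>U\<in>\<U>. card U \<ge> t"
  shows "\<forall>S \<in> IT G \<U>. \<forall>T \<in> IT G \<U>. reconfigurable G \<U> S T"
proof -
  note P = assms(5)
  interpret G: pair_graph G by (rule assms(3))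
  interpret R: pair_graph "reconf_graph G \<U>" by (rule pair_graph_reconf_graph[OF assms(3) P])
  have V: "\<Union>\<U> = pverts G" "disjoint \<U>" using P by (auto simp: partition_on_def)
  have finV: "finite (pverts G)" and finE: "finite (parcs G)"
    using G.pair_finite_verts G.pair_finite_arcs by auto
  have finU: "finite \<U>" using finV V(1) finite_UnionD by metis
  have symE: "sym (parcs G)" using G.sym_arcs by (simp add: symmetric_def)
  have size: "\<forall>U\<in>\<U>. 2 * \<Delta> + 1 \<le> card U" using assms(2,6) order_trans by blast
  have deg: "\<forall>v. card (parcs G `` {v}) \<le> \<Delta>"
  proof
    fix v
    show "card (parcs G `` {v}) \<le> \<Delta>"
    proof (cases "v \<in> pverts G")
      case True
      have "out_arcs (with_proj G) v = Pair v ` (parcs G `` {v})" by (auto simp: out_arcs_def)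
      then have "out_degree (with_proj G) v = card (parcs G `` {v})"
        by (simp add: out_degree_def card_image inj_on_def)
      moreover have "out_degree (with_proj G) v \<le> max_degree G"
        unfolding max_degree_def using True finV by (intro Max_ge) auto
      ultimately show ?thesis using assms(4) by simp
    next
      case False
      then have "parcs G `` {v} = {}" using G.in_arcsD1 by blast
      then show ?thesis by simp
    qed
  qed
  have "reachable (with_proj (reconf_graph G \<U>)) S T" if "S \<in> IT G \<U>" "T \<in> IT G \<U>" for S T
    using that
  proof (induction "card {U \<in> \<U>. S \<inter> U \<noteq> T \<inter> U}" arbitrary: S T rule: less_induct)
    case less
    note ST = less.prems
    have SV: "S \<subseteq> \<Union>\<U>" "T \<subseteq> \<Union>\<U>" using ST V(1) by (auto simp: IT_def independent_def)
    define D where "D = {U \<in> \<U>. S \<inter> U \<noteq> T \<inter> U}"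
    show ?case
    proof (cases "D = {}")
      case True
      then have agree: "\<And>U. U \<in> \<U> \<Longrightarrow> S \<inter> U = T \<inter> U" by (auto simp: D_def)
      have "S = (\<Union>U\<in>\<U>. S \<inter> U)" using SV by blast
      also have "\<dots> = (\<Union>U\<in>\<U>. T \<inter> U)" using agree by simp
      also have "\<dots> = T" using SV by blast
      finally have "S = T" .
      then show ?thesis using ST by simp
    next
      case False
      \<comment> \<open>Each block of \<open>D\<close> contributes at most one vertex of
        \<open>S\<close> and one of \<open>T\<close>, which gives the bound
        \<open>2 * card D\<close>.\<close>
      define A where "A = (S \<union> T) \<inter> \<Union>D"
      have "A = (\<Union>U\<in>D. (S \<inter> U) \<union> (T \<inter> U))" by (auto simp: A_def)
      also have "card \<dots> \<le> (\<Sum>U\<in>D. card ((S \<inter> U) \<union> (T \<inter> U)))"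
        using finU by (intro card_UN_le) (simp add: D_def)
      also have "\<dots> \<le> (\<Sum>U\<in>D. 2)"
      proof (rule sum_mono)
        fix U assume "U \<in> D"
        then have "card (S \<inter> U) = 1" "card (T \<inter> U) = 1" using ST by (auto simp: D_def IT_def)
        then show "card ((S \<inter> U) \<union> (T \<inter> U)) \<le> 2" using card_Un_le[of "S \<inter> U" "T \<inter> U"] by linarith
      qed
      finally have cA: "card A \<le> 2 * card D" by simp
      have "A \<subseteq> pverts G" using SV V(1) by (auto simp: A_def)
      then have finA: "finite A" using finV finite_subset by blast
      have agree: "\<forall>U \<in> \<U> - D. S \<inter> U = T \<inter> U" by (auto simp: D_def)
      have "\<forall>U \<in> \<U> - D. \<exists>y. (S \<union> T) \<inter> U = {y}"
        using agree IT_Int_block[OF ST(1)] by (metis DiffD1 Int_Un_distrib2 sup.idem)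
      then obtain W w where W: "(swap (parcs G) \<U> D A)\<^sup>*\<^sup>* (S \<union> T) W" "w \<in> \<Union>D"
        "\<forall>z \<in> W \<union> A. (w, z) \<notin> parcs G"
        using swaps_free_vertex[OF _ V(2) size deg finE symE _ False finA cA, of "S \<union> T"] finV V(1) SV
        by (auto simp: A_def D_def)
      obtain S' T' where S'T': "S' \<in> IT G \<U>" "T' \<in> IT G \<U>" "W = S' \<union> T'"
        "\<forall>U \<in> \<U> - D. S' \<inter> U = T' \<inter> U"
        "reachable (with_proj (reconf_graph G \<U>)) S S'" "reachable (with_proj (reconf_graph G \<U>)) T T'"
        using swaps_lift[OF assms(3) P ST agree W(1)] by blast
      obtain U where U: "U \<in> D" "w \<in> U" using W(2) by blast
      then have UU: "U \<in> \<U>" by (simp add: D_def)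
      \<comment> \<open>This move takes place in a frozen block, where \<open>S'\<close> and
        \<open>T'\<close> may differ, so it is not a swap. It makes them agree on \<open>U\<close>,
        and the swaps have kept agreement outside \<open>D\<close>.\<close>
      let ?S = "insert w (S' - U)" and ?T = "insert w (T' - U)"
      have S2: "?S \<in> IT G \<U>" "reachable (with_proj (reconf_graph G \<U>)) S' ?S"
        and T2: "?T \<in> IT G \<U>" "reachable (with_proj (reconf_graph G \<U>)) T' ?T"
        using IT_exchange[OF assms(3) P _ UU U(2)] S'T' W(3) by auto
      have "{X \<in> \<U>. ?S \<inter> X \<noteq> ?T \<inter> X} \<subseteq> D - {U}" using S'T'(4) by blast
      then have "{X \<in> \<U>. ?S \<inter> X \<noteq> ?T \<inter> X} \<subset> D" using U(1) by blast
      then have "card {X \<in> \<U>. ?S \<inter> X \<noteq> ?T \<inter> X} < card D"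
        using finU by (intro psubset_card_mono) (auto simp: D_def)
      then have "reachable (with_proj (reconf_graph G \<U>)) ?S ?T"
        using less.hyps S2(1) T2(1) unfolding D_def by blast
      \<comment> \<open>The path runs through \<open>S'\<close>, \<open>?S\<close>,
        \<open>?T\<close> and \<open>T'\<close>; its second half is reversed by symmetry.\<close>
      then show ?thesis using S'T'(5,6) S2(2) T2(2) R.reachable_trans R.symmetric_reachable'
        by (meson R.sym_arcs)
    qed
  qed
  then show ?thesis using reconfigurable_iff_reachable[OF assms(3) P] by blast
qed

end
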